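(* Let $A$ be a real $m\times n$ matrix with $m\ge n$, $\operatorname{rank}(A)=n$, which is SR with signature $\varepsilon$. Then $A$ can be factored as $A=QR$, where $Q$ is a real $m\times n$ matrix with $Q^TQ=I_n$ and $R$ is an $n\times n$ nonsingular upper triangular TP matrix.
   Context: $Q_{k,n}$ is the set of strictly increasing sequences of $k$ natural numbers not greater than $n$; $A[\alpha|\beta]$ is the submatrix with rows $\alpha$ and columns $\beta$. An $m\times n$ real matrix $A=(a_{ij})$ is type-I staircase if: (i) $a_{ii}\neq 0$ for all $i\le\min\{m,n\}$; (ii) if $i>j$ and $a_{ij}=0$ then $a_{kl}=0$ for all $k\ge i$, $l\le j$; (iii) if $i<j$ and $a_{ij}=0$ then $a_{kl}=0$ for all $k\le i$, $l\ge j$. With $P_m$ the $m\times m$ backward identity matrix (entries $1$ where $i+j=m+1$, $0$ elsewhere), $A$ is type-II staircase if $P_mA$ is type-I staircase. A signature is a vector with entries $\pm1$. An $m\times n$ matrix $A$ with $\operatorname{rank}(A)=r=\min\{m,n\}$ is SR (sign regular) with signature $\varepsilon=(\varepsilon_1,\dots,\varepsilon_r)$ if it is type-I or type-II staircase and $\varepsilon_k\det A[\alpha|\beta]\ge0$ for all $\alpha\in Q_{k,m}$, $\beta\in Q_{k,n}$, $k\le r$. Such an $A$ is TP (totally positive) if it is SR with signature $(1,1,\dots,1)$. *)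

theory Defs
  imports "Jordan_Normal_Form.DL_Rank_Submatrix"
begin

(* Rows, columns and vector entries are numbered from 0, as in the matrix library;
   the sequences below accordingly take their values in {0..<n}. *)

definition incr_seqs :: "nat \<Rightarrow> nat \<Rightarrow> nat list set" where
  "incr_seqs k n = {\<alpha>. length \<alpha> = k \<and> sorted_wrt (<) \<alpha> \<and> set \<alpha> \<subseteq> {0..<n}}"

(* The library's submatrix is indexed by sets and enumerates them in increasing order,
   so for strictly increasing sequences nothing is lost by passing to the underlying sets;
   see minor_mat_eq. *)
definition minor_mat :: "'a mat \<Rightarrow> nat list \<Rightarrow> nat list \<Rightarrow> 'a mat" where
  "minor_mat A \<alpha> \<beta> = submatrix A (set \<alpha>) (set \<beta>)"

lemma pick_set_incr_seq:
  assumes "sorted_wrt (<) \<alpha>" and "i < length (\<alpha> :: nat list)"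
  shows "pick (set \<alpha>) i = \<alpha> ! i"
proof -
  have inj: "inj_on (\<lambda>j. \<alpha> ! j) {..<i}"
    using assms by (intro inj_onI) (metis lessThan_iff order_less_trans nat_neq_iff sorted_wrt_nth_less)
  have "{a \<in> set \<alpha>. a < \<alpha> ! i} = (\<lambda>j. \<alpha> ! j) ` {..<i}"
  proof (intro equalityI subsetI)
    fix a assume "a \<in> {a \<in> set \<alpha>. a < \<alpha> ! i}"
    then obtain j where j: "j < length \<alpha>" "a = \<alpha> ! j" "\<alpha> ! j < \<alpha> ! i"
      by (auto simp: in_set_conv_nth)
    have "j < i"
      using j assms by (metis nat_neq_iff order_less_asym order_less_irrefl sorted_wrt_nth_less)
    with j show "a \<in> (\<lambda>j. \<alpha> ! j) ` {..<i}" by auto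
  next
    fix a assume "a \<in> (\<lambda>j. \<alpha> ! j) ` {..<i}"
    then show "a \<in> {a \<in> set \<alpha>. a < \<alpha> ! i}"
      using assms by (auto simp: sorted_wrt_nth_less)
  qed
  then have "card {a \<in> set \<alpha>. a < \<alpha> ! i} = i"
    using card_image[OF inj] by simp
  then show ?thesis
    using pick_card_in_set[of "\<alpha> ! i" "set \<alpha>"] assms by simp
qed

lemma minor_mat_eq:
  assumes "\<alpha> \<in> incr_seqs k (dim_row A)" and "\<beta> \<in> incr_seqs k (dim_col A)"
  shows "minor_mat A \<alpha> \<beta> = mat k k (\<lambda>(i, j). A $$ (\<alpha> ! i, \<beta> ! j))"
proof -
  have "{i. i < dim_row A \<and> i \<in> set \<alpha>} = set \<alpha>" "{j. j < dim_col A \<and> j \<in> set \<beta>} = set \<beta>"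
    using assms by (auto simp: incr_seqs_def)
  moreover have "card (set \<alpha>) = k" "card (set \<beta>) = k"
    using assms by (auto simp: incr_seqs_def strict_sorted_iff distinct_card)
  ultimately show ?thesis
    using assms unfolding minor_mat_def submatrix_def
    by (intro eq_matI) (auto simp: incr_seqs_def pick_set_incr_seq)
qed

definition type1_staircase :: "real mat \<Rightarrow> bool" where
  "type1_staircase A \<longleftrightarrow>
     (\<forall>i < min (dim_row A) (dim_col A). A $$ (i, i) \<noteq> 0) \<and>
     (\<forall>i < dim_row A. \<forall>j < dim_col A. i > j \<and> A $$ (i, j) = 0 \<longrightarrow>
        (\<forall>k < dim_row A. \<forall>l < dim_col A. k \<ge> i \<and> l \<le> j \<longrightarrow> A $$ (k, l) = 0)) \<and>
     (\<forall>i < dim_row A. \<forall>j < dim_col A. i < j \<and> A $$ (i, j) = 0 \<longrightarrow>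
        (\<forall>k < dim_row A. \<forall>l < dim_col A. k \<le> i \<and> l \<ge> j \<longrightarrow> A $$ (k, l) = 0))"

(* With 1-based indices the condition on the entries equal to 1 reads i + j = m + 1. *)
definition backward_identity :: "nat \<Rightarrow> real mat" where
  "backward_identity m = mat m m (\<lambda>(i, j). if Suc (i + j) = m then 1 else 0)"

definition type2_staircase :: "real mat \<Rightarrow> bool" where
  "type2_staircase A \<longleftrightarrow> type1_staircase (backward_identity (dim_row A) * A)"

definition is_signature :: "real vec \<Rightarrow> bool" where
  "is_signature \<epsilon> \<longleftrightarrow> (\<forall>i < dim_vec \<epsilon>. \<epsilon> $ i = 1 \<or> \<epsilon> $ i = - 1)"

(* The entry of the signature belonging to the minors of order k has index k - 1. *)
definition sign_regular :: "real mat \<Rightarrow> real vec \<Rightarrow> bool" where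
  "sign_regular A \<epsilon> \<longleftrightarrow>
     (let r = min (dim_row A) (dim_col A) in
       vec_space.rank (dim_row A) A = r \<and>
       dim_vec \<epsilon> = r \<and> is_signature \<epsilon> \<and>
       (type1_staircase A \<or> type2_staircase A) \<and>
       (\<forall>k \<in> {1..r}. \<forall>\<alpha> \<in> incr_seqs k (dim_row A). \<forall>\<beta> \<in> incr_seqs k (dim_col A).
          \<epsilon> $ (k - 1) * det (minor_mat A \<alpha> \<beta>) \<ge> 0))"

definition totally_positive :: "real mat \<Rightarrow> bool" where
  "totally_positive A \<longleftrightarrow>
     sign_regular A (vec (min (dim_row A) (dim_col A)) (\<lambda>_. 1))"

end

theory Submission
  imports Defs
begin

text \<open>All minors of the Gram matrix \<open>A\<^sup>T A\<close> are nonnegative: by Cauchy--Binet each is a sum of products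
  of two minors of \<open>A\<close> of the same order, and the two signs cancel. Gram--Schmidt gives \<open>A = Q R\<close>, where
  \<open>A\<^sup>T A = R\<^sup>T R\<close> and \<open>R\<close> has positive diagonal, so the minors of \<open>R\<close> on initial rows are nonnegative.
  If they are even positive, then every minor of \<open>R\<close> that is not forced to vanish by triangularity is
  positive: this holds for consecutive rows, and the gaps in a general set of rows are filled with a
  three-term Pluecker relation, as in Fekete's criterion. The general case follows by approximating \<open>R\<close> by
  \<open>R H\<^sub>t\<close>, where \<open>H\<^sub>t\<close> has the entries \<open>(j choose i) t\<^bsup>j-i\<^esup>\<close> and tends to the identity as \<open>t\<close> tends to \<open>0\<close>.
  The staircase pattern of \<open>R\<close> is then read off from its minors of order at most two.\<close>

section \<open>Minors and the Cauchy-Binet formula\<close>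

text \<open>Determinants are taken of index functions, so that selecting rows and columns is mere
  composition and no dimension conditions arise.\<close>

definition det_fun :: "nat \<Rightarrow> (nat \<Rightarrow> nat \<Rightarrow> real) \<Rightarrow> real" where
  "det_fun k M = det (mat k k (\<lambda>(i, j). M i j))"

lemma det_fun_leibniz:
  "det_fun k M = (\<Sum>p | p permutes {0..<k}. signof p * (\<Prod>i=0..<k. M i (p i)))"
  unfolding det_fun_def
  by (subst det_def'[of _ k]) (auto intro!: sum.cong prod.cong simp: permutes_in_image)

lemma det_fun_cong:
  assumes "\<And>i j. i < k \<Longrightarrow> j < k \<Longrightarrow> M i j = N i j"
  shows "det_fun k M = det_fun k N"
  unfolding det_fun_def using assms by (intro arg_cong[where f = det] eq_matI) auto

lemma det_fun_0 [simp]: "det_fun 0 M = 1"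
  unfolding det_fun_def by (simp add: det_dim_zero[OF mat_carrier])

lemma det_fun_transpose: "det_fun k (\<lambda>i j. M j i) = det_fun k M"
proof -
  have "det_fun k (\<lambda>i j. M j i) = det (transpose_mat (mat k k (\<lambda>(i, j). M i j)))"
    unfolding det_fun_def by (intro arg_cong[where f = det] eq_matI) auto
  also have "\<dots> = det_fun k M"
    unfolding det_fun_def by (rule det_transpose[OF mat_carrier])
  finally show ?thesis .
qed

lemma det_fun_mult:
  "det_fun k (\<lambda>i j. \<Sum>l<k. M i l * N l j) = det_fun k M * det_fun k N"
proof -
  have "mat k k (\<lambda>(i, j). \<Sum>l<k. M i l * N l j)
      = mat k k (\<lambda>(i, j). M i j) * mat k k (\<lambda>(i, j). N i j)"
    by (intro eq_matI) (auto simp: scalar_prod_def atLeast0LessThan)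
  then show ?thesis
    unfolding det_fun_def by (simp add: det_mult[OF mat_carrier mat_carrier])
qed

lemma det_fun_permute_rows:
  assumes "p permutes {0..<k}"
  shows "det_fun k (\<lambda>i j. M (p i) j) = signof p * det_fun k M"
proof -
  have "det_fun k (\<lambda>i j. M (p i) j)
      = det (mat k k (\<lambda>(i, j). mat k k (\<lambda>(i, j). M i j) $$ (p i, j)))"
    unfolding det_fun_def using assms
    by (intro arg_cong[where f = det] eq_matI) (auto simp: permutes_in_image)
  also have "\<dots> = signof p * det_fun k M"
    unfolding det_fun_def by (rule det_permute_rows[OF mat_carrier assms])
  finally show ?thesis .
qed

lemma det_fun_permute_cols:
  assumes "p permutes {0..<k}"
  shows "det_fun k (\<lambda>i j. M i (p j)) = signof p * det_fun k M"
  using det_fun_permute_rows[OF assms, of "\<lambda>i j. M j i"]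
    det_fun_transpose[of k M] det_fun_transpose[of k "\<lambda>i j. M i (p j)"] by simp

lemma det_fun_identical_rows:
  assumes "i < k" "j < k" "i \<noteq> j" "\<And>l. l < k \<Longrightarrow> M i l = M j l"
  shows "det_fun k M = 0"
  unfolding det_fun_def
  by (rule det_identical_rows[OF mat_carrier assms(3,1,2)]) (use assms in \<open>auto intro!: eq_vecI\<close>)

lemma det_fun_upper_triangular:
  assumes "\<And>i j. i < k \<Longrightarrow> j < i \<Longrightarrow> M i j = 0"
  shows "det_fun k M = (\<Prod>i<k. M i i)"
proof -
  have "det_fun k M = prod_list (diag_mat (mat k k (\<lambda>(i, j). M i j)))"
    unfolding det_fun_def
    by (rule det_upper_triangular[OF _ mat_carrier]) (use assms in auto)
  also have "\<dots> = (\<Prod>i<k. M i i)"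
    by (simp add: prod_list_diag_prod atLeast0LessThan)
  finally show ?thesis .
qed

text \<open>Every Leibniz term contains each row factor once and, after reindexing by the
  permutation, each column factor once.\<close>

lemma det_fun_scale:
  "det_fun k (\<lambda>i j. a i * b j * M i j) = (\<Prod>i<k. a i) * (\<Prod>j<k. b j) * det_fun k M"
proof -
  have "(\<Prod>i=0..<k. a i * b (p i) * M i (p i))
      = (\<Prod>i<k. a i) * (\<Prod>j<k. b j) * (\<Prod>i=0..<k. M i (p i))" if "p permutes {0..<k}" for p
    using prod.permute[OF that, of b] by (simp add: prod.distrib atLeast0LessThan comp_def)
  then show ?thesis
    unfolding det_fun_leibniz sum_distrib_left
    by (intro sum.cong refl) (simp add: algebra_simps)
qed

text \<open>Summing over all maps \<open>f\<close> rather than over increasing ones counts each minor \<open>fact k\<close> times,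
  but avoids any bookkeeping of signs.\<close>

lemma cauchy_binet:
  fixes m :: nat
  shows "fact k * det_fun k (\<lambda>i j. \<Sum>l<m. X i l * Y l j)
    = (\<Sum>f \<in> {0..<k} \<rightarrow>\<^sub>E {..<m}. det_fun k (\<lambda>i j. X i (f j)) * det_fun k (\<lambda>i j. Y (f i) j))"
    (is "_ * ?D = sum _ ?F")
proof -
  \<comment> \<open>Multiplying out the row sums chooses one summation index \<open>f i\<close> per
    row; the sum over permutations then acts on \<open>Y\<close> alone.\<close>
  have expand: "?D = (\<Sum>f\<in>?F. (\<Prod>i=0..<k. X i (f i)) * det_fun k (\<lambda>i j. Y (f i) j))"
  proof -
    have "?D = (\<Sum>p | p permutes {0..<k}. \<Sum>f\<in>?F.
        signof p * ((\<Prod>i=0..<k. X i (f i)) * (\<Prod>i=0..<k. Y (f i) (p i))))"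
      unfolding det_fun_leibniz
      by (intro sum.cong refl)
        (simp add: prod_sum_PiE sum_distrib_left prod.distrib)
    also have "\<dots> = (\<Sum>f\<in>?F. \<Sum>p | p permutes {0..<k}.
        signof p * ((\<Prod>i=0..<k. X i (f i)) * (\<Prod>i=0..<k. Y (f i) (p i))))"
      by (rule sum.swap)
    finally show ?thesis
      unfolding det_fun_leibniz sum_distrib_left by (simp add: mult_ac)
  qed
  \<comment> \<open>Precomposing with \<open>p\<close> permutes the maps \<open>f\<close>, and
    reordering the rows of \<open>Y\<close> costs the sign of \<open>p\<close>. Summing over all
    \<open>p\<close> then assembles the minor of \<open>X\<close>.\<close>
  have perm: "?D = (\<Sum>f\<in>?F. signof p * (\<Prod>i=0..<k. X i (f (p i))) * det_fun k (\<lambda>i j. Y (f i) j))"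
    if p: "p permutes {0..<k}" for p
  proof -
    have "bij_betw (\<lambda>f. f \<circ> p) ?F ?F"
    proof (rule bij_betw_byWitness[where f' = "\<lambda>f. f \<circ> inv_into UNIV p"])
      have q: "inv_into UNIV p permutes {0..<k}" by (rule permutes_inv[OF p])
      show "(\<lambda>f. f \<circ> p) ` ?F \<subseteq> ?F" "(\<lambda>f. f \<circ> inv_into UNIV p) ` ?F \<subseteq> ?F"
        using permutes_in_image[OF p] permutes_in_image[OF q]
        by (auto simp: PiE_iff extensional_def)
      show "\<forall>f\<in>?F. f \<circ> p \<circ> inv_into UNIV p = f" "\<forall>f\<in>?F. f \<circ> inv_into UNIV p \<circ> p = f"
        using permutes_inv_o[OF p] by (simp_all add: comp_assoc)
    qed
    then have "?D = (\<Sum>f\<in>?F. (\<Prod>i=0..<k. X i ((f \<circ> p) i)) * det_fun k (\<lambda>i j. Y ((f \<circ> p) i) j))"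
      unfolding expand by (rule sum.reindex_bij_betw[symmetric])
    then show ?thesis
      by (simp add: det_fun_permute_rows[OF p, of "\<lambda>i. Y (f i)" for f] mult_ac)
  qed
  have "fact k * ?D = (\<Sum>p | p permutes {0..<k}. ?D)"
    by (simp add: card_permutations)
  also have "\<dots> = (\<Sum>p | p permutes {0..<k}. \<Sum>f\<in>?F.
      signof p * (\<Prod>i=0..<k. X i (f (p i))) * det_fun k (\<lambda>i j. Y (f i) j))"
    using perm by (intro sum.cong) auto
  also have "\<dots> = (\<Sum>f\<in>?F. \<Sum>p | p permutes {0..<k}.
      signof p * (\<Prod>i=0..<k. X i (f (p i))) * det_fun k (\<lambda>i j. Y (f i) j))"
    by (rule sum.swap)
  also have "\<dots> = (\<Sum>f\<in>?F. det_fun k (\<lambda>i j. X i (f j)) * det_fun k (\<lambda>i j. Y (f i) j))"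
    unfolding sum_distrib_right[symmetric] det_fun_leibniz[of k "\<lambda>i j. X i (f j)" for f] ..
  finally show ?thesis .
qed

text \<open>The permutation sends \<open>i\<close> to the argument at which \<open>f\<close> takes
  its \<open>i\<close>-th smallest value. It reduces arbitrary injective choices of rows to
  increasing ones.\<close>

lemma inj_on_sort_obtain:
  fixes f :: "nat \<Rightarrow> nat"
  assumes "inj_on f {0..<k}"
  obtains p where "p permutes {0..<k}" "strict_mono_on {..<k} (f \<circ> p)"
proof -
  define xs where "xs = sorted_list_of_set (f ` {0..<k})"
  have len: "length xs = k"
    using assms by (simp add: xs_def card_image)
  have mono: "xs ! i < xs ! j" if "i < j" "j < k" for i j
    using strict_sorted_list_of_set[of "f ` {0..<k}"] that len
    unfolding xs_def by (metis sorted_wrt_nth_less)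
  have set: "set xs = f ` {0..<k}"
    by (simp add: xs_def)
  define p where "p i = (if i < k then the_inv_into {0..<k} f (xs ! i) else i)" for i
  have fp: "f (p i) = xs ! i" and pk: "p i < k" if "i < k" for i
  proof -
    have "xs ! i \<in> f ` {0..<k}"
      using that len set nth_mem by metis
    then show "f (p i) = xs ! i" "p i < k"
      using that f_the_inv_into_f[OF assms, of "xs ! i"] the_inv_into_into[OF assms, of "xs ! i" "{0..<k}"]
      by (auto simp: p_def)
  qed
  have "inj_on p {0..<k}"
  proof (rule inj_onI)
    fix x y assume "x \<in> {0..<k}" "y \<in> {0..<k}" "p x = p y"
    then have "xs ! x = xs ! y" "x < k" "y < k" using fp by (metis atLeastLessThan_iff)+ 
    then show "x = y" using mono by (metis less_irrefl nat_neq_iff)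
  qed
  moreover have "p ` {0..<k} \<subseteq> {0..<k}"
    using pk by auto
  ultimately have "bij_betw p {0..<k} {0..<k}"
    by (simp add: bij_betw_def endo_inj_surj)
  then have "p permutes {0..<k}"
    by (rule bij_imp_permutes) (auto simp: p_def)
  moreover have "strict_mono_on {..<k} (f \<circ> p)"
    using fp mono by (auto intro!: strict_mono_onI)
  ultimately show ?thesis by (rule that)
qed

text \<open>A repeated value of \<open>f\<close> gives two equal rows. Otherwise sorting
  \<open>f\<close> multiplies both minors by the same sign, which squares to 1.\<close>

lemma cauchy_binet_term_nonneg:
  fixes m :: nat
  assumes "\<And>g. strict_mono_on {..<k} g \<Longrightarrow> g ` {..<k} \<subseteq> {..<m} \<Longrightarrow>
      det_fun k (\<lambda>i j. X i (g j)) * det_fun k (\<lambda>i j. Y (g i) j) \<ge> 0"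
    and f: "f \<in> {0..<k} \<rightarrow>\<^sub>E {..<m}"
  shows "det_fun k (\<lambda>i j. X i (f j)) * det_fun k (\<lambda>i j. Y (f i) j) \<ge> 0"
proof (cases "inj_on f {0..<k}")
  case False
  then obtain a b where "a < k" "b < k" "a \<noteq> b" "f a = f b"
    by (auto simp: inj_on_def)
  then have "det_fun k (\<lambda>i j. Y (f i) j) = 0"
    by (intro det_fun_identical_rows[of a k b]) auto
  then show ?thesis by simp
next
  case True
  then obtain p where p: "p permutes {0..<k}" "strict_mono_on {..<k} (f \<circ> p)"
    using inj_on_sort_obtain[OF True] by blast
  have "(f \<circ> p) ` {..<k} \<subseteq> {..<m}"
    using f permutes_image[OF p(1)] by (auto simp: atLeast0LessThan PiE_iff)
  then have "0 \<le> det_fun k (\<lambda>i j. X i ((f \<circ> p) j)) * det_fun k (\<lambda>i j. Y ((f \<circ> p) i) j)"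
    using assms(1) p(2) by blast
  also have "\<dots> = signof p * signof p * (det_fun k (\<lambda>i j. X i (f j)) * det_fun k (\<lambda>i j. Y (f i) j))"
    using det_fun_permute_cols[OF p(1), of "\<lambda>i j. X i (f j)"]
      det_fun_permute_rows[OF p(1), of "\<lambda>i j. Y (f i) j"] by (simp add: mult_ac)
  also have "signof p * signof p = (1::real)"
    by (simp add: sign_def)
  finally show ?thesis by simp
qed

lemma cauchy_binet_nonneg:
  fixes m :: nat
  assumes "\<And>g. strict_mono_on {..<k} g \<Longrightarrow> g ` {..<k} \<subseteq> {..<m} \<Longrightarrow>
      det_fun k (\<lambda>i j. X i (g j)) * det_fun k (\<lambda>i j. Y (g i) j) \<ge> 0"
  shows "det_fun k (\<lambda>i j. \<Sum>l<m. X i l * Y l j) \<ge> 0" (is "?D \<ge> 0")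
proof (rule ccontr)
  assume "\<not> ?D \<ge> 0"
  then have "fact k * ?D < 0"
    by (intro mult_pos_neg) simp_all
  moreover have "fact k * ?D \<ge> 0"
    unfolding cauchy_binet using cauchy_binet_term_nonneg[of k m X Y, OF assms] by (intro sum_nonneg) blast
  ultimately show False by simp
qed

lemma cauchy_binet_pos:
  fixes m :: nat
  assumes "\<And>g. strict_mono_on {..<k} g \<Longrightarrow> g ` {..<k} \<subseteq> {..<m} \<Longrightarrow>
      det_fun k (\<lambda>i j. X i (g j)) * det_fun k (\<lambda>i j. Y (g i) j) \<ge> 0"
    and h: "h ` {..<k} \<subseteq> {..<m}"
      "det_fun k (\<lambda>i j. X i (h j)) * det_fun k (\<lambda>i j. Y (h i) j) > 0"
  shows "det_fun k (\<lambda>i j. \<Sum>l<m. X i l * Y l j) > 0"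
proof -
  \<comment> \<open>The Cauchy-Binet sum runs over extensional functions; cutting \<open>h\<close>
    down to its first \<open>k\<close> arguments leaves both minors unchanged.\<close>
  let ?h = "restrict h {0..<k}"
  have "det_fun k (\<lambda>i j. X i (?h j)) = det_fun k (\<lambda>i j. X i (h j))"
    "det_fun k (\<lambda>i j. Y (?h i) j) = det_fun k (\<lambda>i j. Y (h i) j)"
    by (auto intro!: det_fun_cong)
  moreover have "?h \<in> {0..<k} \<rightarrow>\<^sub>E {..<m}" using h(1) by fastforce
  ultimately have "fact k * det_fun k (\<lambda>i j. \<Sum>l<m. X i l * Y l j) > 0"
    unfolding cauchy_binet using h(2) cauchy_binet_term_nonneg[of k m X Y, OF assms(1)]
    by (intro sum_pos2[of _ ?h]) (auto intro: finite_PiE)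
  then show ?thesis by (simp add: zero_less_mult_iff)
qed

section \<open>Minors of triangular matrices\<close>

lemma det_fun_expand_first_column:
  "det_fun (Suc k) M
    = (\<Sum>i\<le>k. (- 1) ^ i * M i 0 * det_fun k (\<lambda>r j. M (insert_index i r) (Suc j)))"
proof -
  let ?A = "mat (Suc k) (Suc k) (\<lambda>(i, j). M i j)"
  have del: "mat_delete ?A i 0 = mat k k (\<lambda>(r, j). M (insert_index i r) (Suc j))" if "i \<le> k" for i
    using that by (intro eq_matI) (auto simp: mat_delete_def insert_index_def)
  have "det_fun (Suc k) M = (\<Sum>i<Suc k. ?A $$ (i, 0) * cofactor ?A i 0)"
    unfolding det_fun_def by (rule laplace_expansion_column[OF mat_carrier]) simp
  also have "\<dots> = (\<Sum>i\<le>k. (- 1) ^ i * M i 0 * det_fun k (\<lambda>r j. M (insert_index i r) (Suc j)))"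
    unfolding lessThan_Suc_atMost
    by (intro sum.cong refl) (simp add: cofactor_def del det_fun_def)
  finally show ?thesis .
qed

lemma det_fun_column_dependent:
  assumes "\<And>i. i < k \<Longrightarrow> (\<Sum>j<k. c j * M i j) = 0" and "j < k" "c j \<noteq> 0"
  shows "det_fun k M = 0"
proof -
  let ?A = "mat k k (\<lambda>(i, j). M i j)"
  have "vec k c \<noteq> 0\<^sub>v k"
    using assms(2,3) by (metis index_vec index_zero_vec(1))
  moreover have "?A *\<^sub>v vec k c = 0\<^sub>v k"
    using assms(1) by (intro eq_vecI) (auto simp: scalar_prod_def atLeast0LessThan mult.commute)
  ultimately show ?thesis
    unfolding det_fun_def using det_0_iff_vec_prod_zero_field[OF mat_carrier] vec_carrier by blast
qed

text \<open>Put a linear combination of the \<open>k\<close> columns in front of them: the resulting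
  determinant of order \<open>k + 1\<close> vanishes, and its expansion along the new column is this
  identity.\<close>

lemma laplace_in_column_span:
  fixes X :: "nat \<Rightarrow> nat \<Rightarrow> real"
  shows "(\<Sum>i\<le>k. (- 1) ^ i * (\<Sum>j<k. c j * X i j) * det_fun k (\<lambda>r. X (insert_index i r))) = 0"
proof -
  define M where "M i j = (case j of 0 \<Rightarrow> (\<Sum>j<k. c j * X i j) | Suc j \<Rightarrow> X i j)" for i j
  define d where "d j = (case j of 0 \<Rightarrow> 1 | Suc j \<Rightarrow> - c j)" for j
  have "det_fun (Suc k) M = 0"
    by (rule det_fun_column_dependent[of _ d _ 0])
      (simp_all add: d_def M_def sum.lessThan_Suc_shift sum_negf del: sum.lessThan_Suc)
  then show ?thesis
    unfolding det_fun_expand_first_column by (simp add: M_def)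
qed

lemma det_fun_solve:
  assumes "det_fun k M \<noteq> 0"
  obtains c where "\<And>i. i < k \<Longrightarrow> (\<Sum>j<k. c j * M i j) = b i"
proof -
  let ?A = "mat k k (\<lambda>(i, j). M i j)"
  obtain B where B: "B \<in> carrier_mat k k" "?A * B = 1\<^sub>m k"
    using det_non_zero_imp_unit[OF mat_carrier, of k "\<lambda>(i, j). M i j" undefined] assms
    by (auto simp: det_fun_def Units_def ring_mat_def)
  have "?A *\<^sub>v (B *\<^sub>v vec k b) = vec k b"
    using B by (simp flip: assoc_mult_mat_vec[where A = ?A and n\<^sub>1 = k and n\<^sub>2 = k and n\<^sub>3 = k])
  then have "(\<Sum>j<k. (B *\<^sub>v vec k b) $ j * M i j) = b i" if "i < k" for i
  proof -
    have "b i = (?A *\<^sub>v (B *\<^sub>v vec k b)) $ i"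
      using \<open>?A *\<^sub>v (B *\<^sub>v vec k b) = vec k b\<close> that by simp
    also have "\<dots> = (\<Sum>j<k. (B *\<^sub>v vec k b) $ j * M i j)"
      using that B(1) by (simp add: scalar_prod_def atLeast0LessThan mult.commute)
    finally show ?thesis by simp
  qed
  then show thesis by (rule that)
qed

text \<open>The distinguished rows among \<open>0, ..., k + 1\<close> are \<open>0\<close>,
  \<open>s\<close> and \<open>k + 1\<close>. Since the minor on rows and columns
  \<open>1, ..., k\<close> is nonzero, some combination \<open>w\<close> of these columns is the
  unit vector at \<open>s\<close> on these rows. Three Laplace identities for \<open>w\<close> then
  determine \<open>w 0\<close> and \<open>w (Suc k)\<close> and relate the minors.\<close>

lemma plucker_three_term:
  fixes X :: "nat \<Rightarrow> nat \<Rightarrow> real"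
  assumes s: "0 < s" "s \<le> k"
    and nz: "det_fun k (\<lambda>i j. X (Suc i) (Suc j)) \<noteq> 0"
  shows "det_fun (Suc k) (\<lambda>i. X (insert_index s i)) * det_fun k (\<lambda>i j. X (Suc i) (Suc j))
    = det_fun (Suc k) (\<lambda>i. X (Suc i)) * det_fun k (\<lambda>i j. X (insert_index s i) (Suc j))
    + det_fun (Suc k) X * det_fun k (\<lambda>i j. X (Suc (insert_index (s - 1) i)) (Suc j))"
    (is "?Ms * ?P = ?M0 * ?Msk + ?Mk * ?M0s")
proof -
  obtain c where c: "\<And>i. i < k \<Longrightarrow> (\<Sum>j<k. c j * X (Suc i) (Suc j)) = (if Suc i = s then 1 else 0)"
    using det_fun_solve[OF nz, of "\<lambda>i. if Suc i = s then 1 else 0"] by blast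
  define w where "w i = (\<Sum>j<k. c j * X i (Suc j))" for i
  have w: "w i = (if i = s then 1 else 0)" if "0 < i" "i \<le> k" for i
    using c[of "i - 1"] that by (simp add: w_def)
  \<comment> \<open>On rows \<open>0, ..., k\<close> only rows \<open>0\<close> and \<open>s\<close>
    contribute.\<close>
  have first: "w 0 * ?P + (- 1) ^ s * ?Msk = 0"
  proof -
    have "0 = (\<Sum>i\<le>k. (- 1) ^ i * w i * det_fun k (\<lambda>r j. X (insert_index i r) (Suc j)))"
      using laplace_in_column_span[where k = k and c = c and X = "\<lambda>i j. X i (Suc j)"] by (simp add: w_def)
    also have "\<dots> = (\<Sum>i\<in>{0, s}. (- 1) ^ i * w i * det_fun k (\<lambda>r j. X (insert_index i r) (Suc j)))"
      using s w by (intro sum.mono_neutral_right) auto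
    finally show ?thesis using s w by (simp add: insert_index_def)
  qed
  \<comment> \<open>On rows \<open>1, ..., k + 1\<close> only rows \<open>s\<close> and
    \<open>k + 1\<close> contribute; all positions are shifted down by one, hence the exponent
    \<open>s - 1\<close>.\<close>
  have last: "(- 1) ^ (s - 1) * ?M0s + (- 1) ^ k * w (Suc k) * ?P = 0"
  proof -
    have "0 = (\<Sum>i\<le>k. (- 1) ^ i * w (Suc i) * det_fun k (\<lambda>r j. X (Suc (insert_index i r)) (Suc j)))"
      using laplace_in_column_span[where k = k and c = c and X = "\<lambda>i j. X (Suc i) (Suc j)"] by (simp add: w_def)
    also have "\<dots> = (\<Sum>i\<in>{s - 1, k}. (- 1) ^ i * w (Suc i) * det_fun k (\<lambda>r j. X (Suc (insert_index i r)) (Suc j)))"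
      using s w by (intro sum.mono_neutral_right) auto
    also have "det_fun k (\<lambda>r j. X (Suc (insert_index k r)) (Suc j)) = ?P"
      by (rule det_fun_cong) (simp add: insert_index_def)
    then have "(\<Sum>i\<in>{s - 1, k}. (- 1) ^ i * w (Suc i) * det_fun k (\<lambda>r j. X (Suc (insert_index i r)) (Suc j)))
      = (- 1) ^ (s - 1) * ?M0s + (- 1) ^ k * w (Suc k) * ?P"
      using s w by (simp add: mult.assoc)
    finally show ?thesis by simp
  qed
  \<comment> \<open>Here all rows and all columns enter; \<open>case_nat 0 c\<close> gives column
    \<open>0\<close> the coefficient 0, so the combination is still \<open>w\<close>.\<close>
  have full: "w 0 * ?M0 + (- 1) ^ s * ?Ms + (- 1) ^ Suc k * w (Suc k) * ?Mk = 0"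
  proof -
    have "0 = (\<Sum>i\<le>Suc k. (- 1) ^ i * w i * det_fun (Suc k) (\<lambda>r. X (insert_index i r)))"
      using laplace_in_column_span[where k = "Suc k" and c = "case_nat 0 c" and X = X]
      by (simp add: w_def sum.lessThan_Suc_shift del: sum.lessThan_Suc sum.atMost_Suc)
    also have "\<dots> = (\<Sum>i\<in>{0, s, Suc k}. (- 1) ^ i * w i * det_fun (Suc k) (\<lambda>r. X (insert_index i r)))"
      using s w by (intro sum.mono_neutral_right) (auto simp: le_Suc_eq)
    also have "det_fun (Suc k) (\<lambda>r. X (insert_index (Suc k) r)) = ?Mk"
      by (rule det_fun_cong) (simp add: insert_index_def)
    then have "(\<Sum>i\<in>{0, s, Suc k}. (- 1) ^ i * w i * det_fun (Suc k) (\<lambda>r. X (insert_index i r)))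
      = w 0 * ?M0 + (- 1) ^ s * ?Ms + (- 1) ^ Suc k * w (Suc k) * ?Mk"
      using s w by (simp add: insert_index_def)
    finally show ?thesis by simp
  qed
  define \<sigma> :: real where "\<sigma> = (- 1) ^ (s - 1)"
  define \<tau> :: real where "\<tau> = (- 1) ^ k"
  have \<sigma>: "(- 1) ^ s = - \<sigma>" "\<sigma> \<noteq> 0"
    using s by (cases s; simp add: \<sigma>_def)+
  have 1: "w 0 * ?P = \<sigma> * ?Msk" and 2: "\<tau> * w (Suc k) * ?P = - (\<sigma> * ?M0s)"
    and 3: "\<sigma> * ?Ms = w 0 * ?M0 - \<tau> * w (Suc k) * ?Mk"
    using first last full unfolding power_Suc \<sigma>(1) \<tau>_def[symmetric] \<sigma>_def[symmetric] by linarith+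
  have "\<sigma> * (?Ms * ?P) = (\<sigma> * ?Ms) * ?P"
    by (simp only: mult.assoc)
  also have "\<dots> = (w 0 * ?P) * ?M0 - (\<tau> * w (Suc k) * ?P) * ?Mk"
    unfolding 3 by (simp add: algebra_simps)
  also have "\<dots> = \<sigma> * (?M0 * ?Msk + ?Mk * ?M0s)"
    unfolding 1 2 by (simp add: algebra_simps)
  finally show ?thesis
    using \<sigma>(2) by simp
qed

section \<open>Zero pattern and positivity of minors of triangular matrices\<close>

text \<open>Pigeonhole: the \<open>k - i\<close> rows from \<open>i\<close> on cannot all be sent to
  the \<open>k - i - 1\<close> columns beyond \<open>i\<close>, so every Leibniz term meets the zero
  block.\<close>

lemma det_fun_zero_block:
  assumes "i < k" "\<And>r c. i \<le> r \<Longrightarrow> r < k \<Longrightarrow> c \<le> i \<Longrightarrow> M r c = 0"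
  shows "det_fun k M = 0"
  unfolding det_fun_leibniz
proof (rule sum.neutral, safe)
  fix p assume p: "p permutes {0..<k}"
  have "\<exists>r\<in>{i..<k}. p r \<le> i"
  proof (rule ccontr)
    assume "\<not> ?thesis"
    then have "p ` {i..<k} \<subseteq> {Suc i..<k}"
      using permutes_in_image[OF p] by (auto simp: not_le Suc_le_eq)
    then have "card (p ` {i..<k}) \<le> card {Suc i..<k}"
      by (rule card_mono[rotated]) simp
    moreover have "card (p ` {i..<k}) = card {i..<k}"
      by (rule card_image) (rule inj_on_subset[OF permutes_inj[OF p]], simp)
    ultimately show False using assms(1) by simp
  qed
  then obtain r where "i \<le> r" "r < k" "p r \<le> i" by auto
  then have "(\<Prod>i=0..<k. M i (p i)) = 0"
    using assms(2) by (intro prod_zero) (auto intro!: bexI[of _ r])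
  then show "real_of_int (sign p) * (\<Prod>i=0..<k. M i (p i)) = 0" by simp
qed

lemma upper_triangular_minor_eq_0:
  fixes V :: "nat \<Rightarrow> nat \<Rightarrow> real"
  assumes upper: "\<And>i j. i < n \<Longrightarrow> j < i \<Longrightarrow> V i j = 0"
    and \<alpha>: "strict_mono_on {..<k} \<alpha>" "\<alpha> ` {..<k} \<subseteq> {..<n}" and \<beta>: "strict_mono_on {..<k} \<beta>"
    and i: "i < k" "\<beta> i < \<alpha> i"
  shows "det_fun k (\<lambda>i j. V (\<alpha> i) (\<beta> j)) = 0"
proof (rule det_fun_zero_block[OF i(1)])
  fix r c assume r: "i \<le> r" "r < k" "c \<le> i"
  have "\<beta> c \<le> \<beta> i"
    by (rule strict_mono_on_leD[OF \<beta>]) (use r i in auto)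
  moreover have "\<alpha> i \<le> \<alpha> r"
    by (rule strict_mono_on_leD[OF \<alpha>(1)]) (use r i in auto)
  moreover have "\<alpha> r < n"
    using \<alpha>(2) r by auto
  ultimately show "V (\<alpha> r) (\<beta> c) = 0"
    using i(2) by (intro upper) auto
qed

text \<open>Induction on the first row: enlarge the minor by row \<open>a\<close> and column
  \<open>a\<close>. On the rows from \<open>a\<close> on, this column has only its diagonal entry,
  so the larger minor is \<open>V a a\<close> times the desired one.\<close>

lemma consecutive_minor_pos:
  fixes V :: "nat \<Rightarrow> nat \<Rightarrow> real"
  assumes upper: "\<And>i j. i < n \<Longrightarrow> j < i \<Longrightarrow> V i j = 0"
    and diag: "\<And>i. i < n \<Longrightarrow> V i i > 0"
    and flag: "\<And>k \<beta>. strict_mono_on {..<k} \<beta> \<Longrightarrow> \<beta> ` {..<k} \<subseteq> {..<n} \<Longrightarrow>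
      det_fun k (\<lambda>i j. V i (\<beta> j)) > 0"
  shows "strict_mono_on {..<k} \<beta> \<Longrightarrow> \<beta> ` {..<k} \<subseteq> {..<n} \<Longrightarrow> \<forall>j<k. a + j \<le> \<beta> j \<Longrightarrow>
      det_fun k (\<lambda>i j. V (a + i) (\<beta> j)) > 0"
proof (induction a arbitrary: k \<beta>)
  case 0
  then show ?case using flag by simp
next
  case (Suc a)
  show ?case
  proof (cases "k = 0")
    case False
    let ?\<gamma> = "case_nat a \<beta>"
    have an: "a + k < n"
    proof -
      have "k - 1 < k" using False by simp
      then have "\<beta> (k - 1) < n" "Suc a + (k - 1) \<le> \<beta> (k - 1)"
        using Suc.prems(2,3) by blast+
      then show ?thesis using False by simp
    qed
    have "strict_mono_on {..<Suc k} ?\<gamma>"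
    proof (rule strict_mono_onI)
      fix r s assume "r \<in> {..<Suc k}" "s \<in> {..<Suc k}" "r < s"
      then show "?\<gamma> r < ?\<gamma> s"
        using Suc.prems(3)[rule_format, of "s - 1"] strict_mono_onD[OF Suc.prems(1), of "r - 1" "s - 1"]
        by (auto split: nat.splits)
    qed
    moreover have "?\<gamma> ` {..<Suc k} \<subseteq> {..<n}"
      using Suc.prems(2) an by (auto simp: image_subset_iff split: nat.splits)
    moreover have "\<forall>j<Suc k. a + j \<le> ?\<gamma> j"
      using Suc.prems(3) by (simp split: nat.splits)
    ultimately have "0 < det_fun (Suc k) (\<lambda>i j. V (a + i) (?\<gamma> j))"
      by (rule Suc.IH)
    also have "\<dots> = (\<Sum>i\<le>k. (- 1) ^ i * V (a + i) a *
        det_fun k (\<lambda>r j. V (a + insert_index i r) (\<beta> j)))"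
      unfolding det_fun_expand_first_column by simp
    also have "\<dots> = (\<Sum>i\<in>{0}. (- 1) ^ i * V (a + i) a *
        det_fun k (\<lambda>r j. V (a + insert_index i r) (\<beta> j)))"
      using an upper by (intro sum.mono_neutral_right) auto
    finally have "V a a * det_fun k (\<lambda>i j. V (Suc a + i) (\<beta> j)) > 0"
      by (simp add: insert_index_def)
    then show ?thesis
      using diag[of a] an by (simp add: zero_less_mult_iff)
  qed simp
qed

lemma strict_mono_on_unit_steps:
  fixes \<alpha> :: "nat \<Rightarrow> nat"
  assumes "\<And>i. Suc i < k \<Longrightarrow> \<alpha> (Suc i) = Suc (\<alpha> i)" "i < k"
  shows "\<alpha> i = \<alpha> 0 + i"
  using assms(2) by (induction i) (use assms(1) in auto)

text \<open>If a row \<open>q\<close> is skipped by \<open>\<alpha>\<close>, the three-term relation for the rows of \<open>\<alpha>\<close> together with \<open>q\<close>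
  expresses the minor through minors of smaller order or smaller spread.\<close>

lemma upper_triangular_minor_pos:
  fixes V :: "nat \<Rightarrow> nat \<Rightarrow> real"
  assumes upper: "\<And>i j. i < n \<Longrightarrow> j < i \<Longrightarrow> V i j = 0"
    and diag: "\<And>i. i < n \<Longrightarrow> V i i > 0"
    and flag: "\<And>k \<beta>. strict_mono_on {..<k} \<beta> \<Longrightarrow> \<beta> ` {..<k} \<subseteq> {..<n} \<Longrightarrow>
      det_fun k (\<lambda>i j. V i (\<beta> j)) > 0"
  shows "strict_mono_on {..<k} \<alpha> \<Longrightarrow> \<alpha> ` {..<k} \<subseteq> {..<n} \<Longrightarrow>
    strict_mono_on {..<k} \<beta> \<Longrightarrow> \<beta> ` {..<k} \<subseteq> {..<n} \<Longrightarrow> \<forall>i<k. \<alpha> i \<le> \<beta> i \<Longrightarrow>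
    det_fun k (\<lambda>i j. V (\<alpha> i) (\<beta> j)) > 0"
proof (induction k arbitrary: \<alpha> \<beta>)
  case 0
  then show ?case by simp
next
  case (Suc k)
  have \<beta>: "strict_mono_on {..<Suc k} \<beta>" "\<beta> ` {..<Suc k} \<subseteq> {..<n}" by fact+
  have \<beta>': "strict_mono_on {..<k} (\<lambda>j. \<beta> (Suc j))" "(\<lambda>j. \<beta> (Suc j)) ` {..<k} \<subseteq> {..<n}"
    using \<beta> by (auto simp: image_subset_iff intro!: strict_mono_onI dest: strict_mono_onD)
  \<comment> \<open>The minors of order \<open>k\<close> in the three-term relation all omit the
    first column, so the outer induction covers them.\<close>
  have small: "det_fun k (\<lambda>i j. V (\<gamma> i) (\<beta> (Suc j))) > 0"
    if "strict_mono_on {..<k} \<gamma>" "\<forall>i<k. \<gamma> i \<le> \<beta> (Suc i)" for \<gamma>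
  proof -
    have "\<gamma> ` {..<k} \<subseteq> {..<n}"
      using that(2) \<beta>'(2) by (auto simp: image_subset_iff intro: le_less_trans)
    then show ?thesis using Suc.IH[OF that(1) _ \<beta>' that(2)] by blast
  qed
  show ?case
    using Suc.prems(1,2,5)
  \<comment> \<open>Inner induction on the spread of the rows, with the columns fixed.\<close>
  proof (induction "\<alpha> k - \<alpha> 0" arbitrary: \<alpha> rule: less_induct)
    case (less \<alpha>)
    have \<alpha>D: "\<alpha> i < \<alpha> j" if "i < j" "j \<le> k" for i j
      using strict_mono_onD[OF less.prems(1)] that by simp
    have nonneg: "det_fun (Suc k) (\<lambda>i j. V (\<gamma> i) (\<beta> j)) \<ge> 0"
      if "strict_mono_on {..<Suc k} \<gamma>" "\<gamma> ` {..<Suc k} \<subseteq> {..<n}" "\<gamma> k - \<gamma> 0 < \<alpha> k - \<alpha> 0" for \<gamma>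
    proof (cases "\<forall>i<Suc k. \<gamma> i \<le> \<beta> i")
      case True
      then show ?thesis using less.hyps[OF that(3,1,2)] by simp
    next
      case False
      then obtain i where "i < Suc k" "\<beta> i < \<gamma> i" by (auto simp: not_le)
      then show ?thesis
        using upper_triangular_minor_eq_0[where V = V and n = n, OF upper that(1,2) \<beta>(1)] by simp
    qed
    show ?case
    proof (cases "\<forall>i. Suc i < Suc k \<longrightarrow> \<alpha> (Suc i) = Suc (\<alpha> i)")
      case True
      then have run: "\<alpha> i = \<alpha> 0 + i" if "i < Suc k" for i
        using strict_mono_on_unit_steps[of "Suc k" \<alpha> i] that by blast
      have "det_fun (Suc k) (\<lambda>i j. V (\<alpha> i) (\<beta> j)) = det_fun (Suc k) (\<lambda>i j. V (\<alpha> 0 + i) (\<beta> j))"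
        by (rule det_fun_cong) (rule arg_cong2[where f = V, OF run refl])
      moreover have "\<alpha> 0 + j \<le> \<beta> j" if "j < Suc k" for j
        using less.prems(3) run[OF that] that by metis
      then have "det_fun (Suc k) (\<lambda>i j. V (\<alpha> 0 + i) (\<beta> j)) > 0"
        by (intro consecutive_minor_pos[where n = n, OF upper diag flag \<beta>]) auto
      ultimately show ?thesis by simp
    next
      case False
      then obtain i where i: "Suc i < Suc k" "\<alpha> (Suc i) \<noteq> Suc (\<alpha> i)" by blast
      define s where "s = Suc i"
      have s: "0 < s" "s \<le> k" and q: "Suc (\<alpha> (s - 1)) < \<alpha> s"
        using i \<alpha>D[of i "Suc i"] by (auto simp: s_def)
      \<comment> \<open>Inserts the skipped row directly after \<alpha> at \<open>s - 1\<close>. The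
        resulting \<open>k + 2\<close> rows are those of the Pluecker relation, and deleting
        position \<open>s\<close> gives back \<alpha>.\<close>
      define \<delta> where "\<delta> r = (if r < s then \<alpha> r else if r = s then Suc (\<alpha> (s - 1)) else \<alpha> (r - 1))" for r
      have \<delta>_Suc: "\<delta> r < \<delta> (Suc r)" if "r \<le> k" for r
      proof -
        consider "Suc r < s" | "Suc r = s" | "r = s" | "s < r" by linarith
        then show ?thesis
        proof cases
          case 4
          then show ?thesis using \<alpha>D[of "r - 1" r] that by (simp add: \<delta>_def)
        qed (use \<alpha>D[of r "Suc r"] q s in \<open>auto simp: \<delta>_def\<close>)
      qed
      have \<delta>: "\<delta> x < \<delta> y" if "x < y" "y \<le> Suc k" for x y
        using that by (induction y) (auto simp: less_Suc_eq intro: \<delta>_Suc less_trans)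
      have \<delta>_ends: "\<delta> 0 = \<alpha> 0" "\<delta> (Suc k) = \<alpha> k"
        using s by (auto simp: \<delta>_def)
      have \<delta>_le: "\<delta> r \<le> \<alpha> r" if "r \<le> k" for r
        using that q \<alpha>D[of "r - 1" r] s by (auto simp: \<delta>_def)
      have \<delta>_n: "\<delta> r < n" if "r \<le> Suc k" for r
      proof -
        have "\<delta> r \<le> \<delta> (Suc k)" using that \<delta>[of r "Suc k"] by (cases "r = Suc k") auto
        also have "\<dots> < n" using \<delta>_ends less.prems(2) by (simp add: image_subset_iff)
        finally show ?thesis .
      qed
      have \<delta>_skip: "\<delta> (insert_index s r) = \<alpha> r" for r
        by (auto simp: \<delta>_def insert_index_def)
      have \<delta>_skip_Suc: "\<delta> (Suc (insert_index (s - 1) r)) = \<alpha> (Suc r)" for r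
        using s by (auto simp: \<delta>_def insert_index_def)
      have less_\<beta>: "\<alpha> r \<le> \<beta> r" if "r \<le> k" for r
        using less.prems(3) that by simp
      have \<beta>_Suc: "\<beta> r < \<beta> (Suc r)" if "r < k" for r
        using strict_mono_onD[OF \<beta>(1)] that by simp
      have \<delta>_\<beta>: "\<delta> r \<le> \<beta> r" if "r \<le> k" for r
        by (rule order_trans[OF \<delta>_le less_\<beta>]) (rule that)+
      have \<alpha>_\<beta>_Suc: "\<alpha> r \<le> \<beta> (Suc r)" if "r < k" for r
        using less_\<beta>[of r] \<beta>_Suc[of r] that by simp
      let ?X = "\<lambda>i j. V (\<delta> i) (\<beta> j)"
      have P: "det_fun k (\<lambda>i j. ?X (Suc i) (Suc j)) > 0"
        using \<delta> \<delta>_\<beta> by (intro small) (auto intro!: strict_mono_onI)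
      have Msk: "det_fun k (\<lambda>i j. ?X (insert_index s i) (Suc j)) > 0"
        unfolding \<delta>_skip using \<alpha>D \<alpha>_\<beta>_Suc by (intro small) (auto intro!: strict_mono_onI)
      have M0s: "det_fun k (\<lambda>i j. ?X (Suc (insert_index (s - 1) i)) (Suc j)) > 0"
        unfolding \<delta>_skip_Suc using \<alpha>D less_\<beta>
        by (intro small) (auto intro!: strict_mono_onI)
      \<comment> \<open>Without the first row, the bound of the rows by the columns may fail, so
        only nonnegativity is available. Strictness comes from the other summand, \<open>Mk\<close>
        times \<open>M0s\<close>.\<close>
      have M0: "det_fun (Suc k) (\<lambda>i. ?X (Suc i)) \<ge> 0"
      proof (rule nonneg)
        show "strict_mono_on {..<Suc k} (\<lambda>i. \<delta> (Suc i))"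
          using \<delta> by (auto intro!: strict_mono_onI)
        show "(\<lambda>i. \<delta> (Suc i)) ` {..<Suc k} \<subseteq> {..<n}"
          using \<delta>_n by auto
        show "\<delta> (Suc k) - \<delta> (Suc 0) < \<alpha> k - \<alpha> 0"
          using \<delta>_ends \<delta>[of 0 "Suc 0"] \<alpha>D[of 0 k] s by auto
      qed
      have Mk: "det_fun (Suc k) ?X > 0"
      proof (rule less.hyps)
        show "\<delta> k - \<delta> 0 < \<alpha> k - \<alpha> 0"
          using \<delta>_ends \<delta>[of k "Suc k"] \<delta>[of 0 k] s by auto
        show "strict_mono_on {..<Suc k} \<delta>"
          using \<delta> by (auto intro!: strict_mono_onI)
        show "\<delta> ` {..<Suc k} \<subseteq> {..<n}"
          using \<delta>_n by auto
        show "\<forall>i<Suc k. \<delta> i \<le> \<beta> i"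
          using \<delta>_\<beta> by (simp add: less_Suc_eq_le)
      qed
      have "det_fun (Suc k) (\<lambda>i j. V (\<alpha> i) (\<beta> j)) * det_fun k (\<lambda>i j. ?X (Suc i) (Suc j)) > 0"
        using plucker_three_term[OF s, of ?X] P Msk M0s M0 Mk \<delta>_skip
        by (simp add: add_nonneg_pos)
      then show ?thesis
        using P by (simp add: zero_less_mult_iff)
    qed
  qed
qed

lemma upper_triangular_minor_nonneg:
  fixes V :: "nat \<Rightarrow> nat \<Rightarrow> real"
  assumes upper: "\<And>i j. i < n \<Longrightarrow> j < i \<Longrightarrow> V i j = 0"
    and diag: "\<And>i. i < n \<Longrightarrow> V i i > 0"
    and flag: "\<And>k \<beta>. strict_mono_on {..<k} \<beta> \<Longrightarrow> \<beta> ` {..<k} \<subseteq> {..<n} \<Longrightarrow>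
      det_fun k (\<lambda>i j. V i (\<beta> j)) > 0"
    and \<alpha>: "strict_mono_on {..<k} \<alpha>" "\<alpha> ` {..<k} \<subseteq> {..<n}"
    and \<beta>: "strict_mono_on {..<k} \<beta>" "\<beta> ` {..<k} \<subseteq> {..<n}"
  shows "det_fun k (\<lambda>i j. V (\<alpha> i) (\<beta> j)) \<ge> 0"
proof (cases "\<forall>i<k. \<alpha> i \<le> \<beta> i")
  case True
  show ?thesis
    by (rule less_imp_le[OF upper_triangular_minor_pos[where V = V and n = n, OF upper diag flag \<alpha> \<beta> True]])
next
  case False
  then obtain i where "i < k" "\<beta> i < \<alpha> i" by (auto simp: not_le)
  then show ?thesis
    using upper_triangular_minor_eq_0[where V = V and n = n, OF upper \<alpha> \<beta>(1)] by simp
qed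

section \<open>Newton bases and minors of the binomial matrix\<close>

text \<open>Both families are monic Newton bases, so the change of basis is unit lower triangular.
  Its recursion comes from splitting \<open>x - y i\<close> as
  \<open>(x - z l) + (z l - y i)\<close>.\<close>

lemma newton_basis_change:
  fixes y z :: "nat \<Rightarrow> real"
  shows "\<exists>c. (\<forall>i. c i i = 1) \<and> (\<forall>i l. i < l \<longrightarrow> c i l = 0) \<and>
    (\<forall>i x. (\<Prod>r<i. x - y r) = (\<Sum>l\<le>i. c i l * (\<Prod>r<l. x - z r)))"
proof -
  define c :: "nat \<Rightarrow> nat \<Rightarrow> real" where
    "c = rec_nat (\<lambda>l. if l = 0 then 1 else 0)
      (\<lambda>i f l. (if l = 0 then 0 else f (l - 1)) + f l * (z l - y i))"
  have c0: "c 0 l = (if l = 0 then 1 else 0)" for l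
    by (simp add: c_def)
  have cS: "c (Suc i) l = (if l = 0 then 0 else c i (l - 1)) + c i l * (z l - y i)" for i l
    by (simp add: c_def)
  have zero: "c i l = 0" if "i < l" for i l
    using that by (induction i arbitrary: l) (auto simp: c0 cS)
  have one: "c i i = 1" for i
    by (induction i) (auto simp: c0 cS zero)
  have "(\<Prod>r<i. x - y r) = (\<Sum>l\<le>i. c i l * (\<Prod>r<l. x - z r))" for i x
  proof (induction i)
    case 0
    then show ?case by (simp add: c0)
  next
    case (Suc i)
    let ?T = "\<lambda>l. \<Prod>r<l. x - z r"
    have "(\<Prod>r<Suc i. x - y r) = (\<Sum>l\<le>i. c i l * ?T l * (x - y i))"
      using Suc.IH by (simp add: sum_distrib_right)
    also have "\<dots> = (\<Sum>l\<le>i. c i l * ?T (Suc l)) + (\<Sum>l\<le>i. c i l * (z l - y i) * ?T l)"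
      by (simp add: algebra_simps flip: sum.distrib)
    also have "(\<Sum>l\<le>i. c i l * ?T (Suc l)) = (\<Sum>l\<le>Suc i. (if l = 0 then 0 else c i (l - 1)) * ?T l)"
      by (simp add: sum.atMost_Suc_shift del: sum.atMost_Suc prod.lessThan_Suc)
    also have "(\<Sum>l\<le>i. c i l * (z l - y i) * ?T l) = (\<Sum>l\<le>Suc i. c i l * (z l - y i) * ?T l)"
      by (simp add: zero)
    finally show ?case
      unfolding sum.distrib[symmetric] distrib_right[symmetric] cS .
  qed
  with zero one show ?thesis by blast
qed

text \<open>A Newton basis with nodes at the evaluation points makes the matrix triangular.\<close>

lemma binomial_flag_minor_pos:
  assumes \<beta>: "strict_mono_on {..<k} (\<beta> :: nat \<Rightarrow> nat)"
  shows "det_fun k (\<lambda>i j. real (\<beta> j choose i)) > 0"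
proof -
  \<comment> \<open>For \<open>j < l\<close> the product contains the factor with
    \<open>r = j\<close>, so \<open>T\<close> is upper triangular; the binomial matrix becomes a
    diagonal matrix times \<open>c\<close> times \<open>T\<close>.\<close>
  define T where "T l j = (\<Prod>r<l. real (\<beta> j) - real (\<beta> r))" for l j
  obtain c where c: "\<And>i. c i i = 1" "\<And>i l. i < l \<Longrightarrow> c i l = 0"
    and basis: "\<And>i x. (\<Prod>r<i. x - real r) = (\<Sum>l\<le>i. c i l * (\<Prod>r<l. x - real (\<beta> r)))"
    using newton_basis_change[of real "\<lambda>r. real (\<beta> r)"] by blast
  have falling: "(\<Prod>r<i. real (\<beta> j) - real r) = (\<Sum>l<k. c i l * T l j)" if "i < k" for i j
    unfolding basis T_def using that c(2) by (intro sum.mono_neutral_left) auto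
  have "det_fun k (\<lambda>i j. real (\<beta> j choose i))
      = det_fun k (\<lambda>i j. (1 / fact i) * 1 * (\<Sum>l<k. c i l * T l j))"
    using falling
    by (intro det_fun_cong) (simp add: binomial_gbinomial gbinomial_prod_rev atLeast0LessThan)
  also have "\<dots> = (\<Prod>i<k. 1 / fact i) * (det_fun k c * det_fun k T)"
    unfolding det_fun_scale det_fun_mult by simp
  also have "det_fun k c = 1"
    using det_fun_upper_triangular[of k "\<lambda>i j. c j i"] c det_fun_transpose[of k c] by simp
  also have "det_fun k T = (\<Prod>i<k. T i i)"
    by (rule det_fun_upper_triangular) (auto simp: T_def)
  finally have "det_fun k (\<lambda>i j. real (\<beta> j choose i)) = (\<Prod>i<k. 1 / fact i) * (\<Prod>i<k. T i i)"
    by simp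
  moreover have "T i i > 0" if "i < k" for i
    unfolding T_def using strict_mono_onD[OF \<beta>, of _ i] that by (intro prod_pos) auto
  ultimately show ?thesis
    by (auto intro!: mult_pos_pos prod_pos)
qed

section \<open>Nonnegative minors by perturbation\<close>

lemma strict_mono_on_card_le:
  fixes \<beta> :: "nat \<Rightarrow> nat"
  assumes "strict_mono_on {..<k} \<beta>" "\<beta> ` {..<k} \<subseteq> {..<n}"
  shows "k \<le> n"
  using card_inj_on_le[OF strict_mono_on_imp_inj_on[OF assms(1)] assms(2)] by simp

lemma tendsto_det_fun:
  assumes "\<And>i j. i < k \<Longrightarrow> j < k \<Longrightarrow> ((\<lambda>t. M t i j) \<longlongrightarrow> L i j) F"
  shows "((\<lambda>t. det_fun k (M t)) \<longlongrightarrow> det_fun k L) F"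
  unfolding det_fun_leibniz
  by (intro tendsto_sum tendsto_mult tendsto_const tendsto_prod assms) (auto simp: permutes_in_image)

text \<open>The upper triangular Pascal matrix, conjugated for nonzero \<open>t\<close> by the
  diagonal matrix of powers of \<open>t\<close>. Truncated subtraction does no harm, since the
  binomial coefficient vanishes for \<open>j < i\<close>.\<close>

definition pascal_kernel :: "real \<Rightarrow> nat \<Rightarrow> nat \<Rightarrow> real" where
  "pascal_kernel t i j = t ^ (j - i) * real (j choose i)"

lemma pascal_kernel_lower [simp]: "j < i \<Longrightarrow> pascal_kernel t i j = 0"
  by (simp add: pascal_kernel_def)

lemma pascal_kernel_diag [simp]: "pascal_kernel t i i = 1"
  by (simp add: pascal_kernel_def)

lemma pascal_kernel_flag_minor_pos:
  assumes "t > 0" "strict_mono_on {..<k} \<beta>"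
  shows "det_fun k (\<lambda>i j. pascal_kernel t i (\<beta> j)) > 0"
proof -
  have "pascal_kernel t i j = (1 / t ^ i) * t ^ j * real (j choose i)" for i j
    using assms(1) by (cases "i \<le> j") (auto simp: pascal_kernel_def power_diff not_le binomial_eq_0)
  then have "det_fun k (\<lambda>i j. pascal_kernel t i (\<beta> j))
      = (\<Prod>i<k. 1 / t ^ i) * (\<Prod>j<k. t ^ \<beta> j) * det_fun k (\<lambda>i j. real (\<beta> j choose i))"
    by (simp only: det_fun_scale)
  then show ?thesis
    using assms by (auto intro!: mult_pos_pos prod_pos binomial_flag_minor_pos)
qed

lemma pascal_kernel_minor_nonneg:
  assumes "t > 0" "strict_mono_on {..<k} \<alpha>" "\<alpha> ` {..<k} \<subseteq> {..<n}"
    "strict_mono_on {..<k} \<beta>" "\<beta> ` {..<k} \<subseteq> {..<n}"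
  shows "det_fun k (\<lambda>i j. pascal_kernel t (\<alpha> i) (\<beta> j)) \<ge> 0"
  by (rule upper_triangular_minor_nonneg[where n = n, OF _ _ _ assms(2-)])
    (simp_all add: pascal_kernel_flag_minor_pos[OF assms(1)])

lemma pascal_kernel_tendsto: "((\<lambda>t. pascal_kernel t i j) \<longlongrightarrow> (if i = j then 1 else 0)) (at_right 0)"
proof (cases "i < j")
  case True
  have "((\<lambda>t::real. t ^ (j - i) * real (j choose i)) \<longlongrightarrow> 0 ^ (j - i) * real (j choose i)) (at_right 0)"
    by (intro tendsto_intros)
  with True show ?thesis by (simp add: pascal_kernel_def zero_power)
next
  case False
  then show ?thesis by (cases "i = j") auto
qed

text \<open>Multiplying by \<open>pascal_kernel t\<close> makes the flag minors strictly positive;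
  then let \<open>t\<close> tend to \<open>0\<close>.\<close>

lemma upper_triangular_flag_nonneg_imp_minor_nonneg:
  fixes R :: "nat \<Rightarrow> nat \<Rightarrow> real"
  assumes upper: "\<And>i j. i < n \<Longrightarrow> j < i \<Longrightarrow> R i j = 0"
    and diag: "\<And>i. i < n \<Longrightarrow> R i i > 0"
    and flag: "\<And>k \<beta>. strict_mono_on {..<k} \<beta> \<Longrightarrow> \<beta> ` {..<k} \<subseteq> {..<n} \<Longrightarrow>
      det_fun k (\<lambda>i j. R i (\<beta> j)) \<ge> 0"
    and \<alpha>: "strict_mono_on {..<k} \<alpha>" "\<alpha> ` {..<k} \<subseteq> {..<n}"
    and \<beta>: "strict_mono_on {..<k} \<beta>" "\<beta> ` {..<k} \<subseteq> {..<n}"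
  shows "det_fun k (\<lambda>i j. R (\<alpha> i) (\<beta> j)) \<ge> 0"
proof -
  define V where "V t i j = (\<Sum>l<n. R i l * pascal_kernel t l j)" for t i j
  have V_upper: "V t i j = 0" if "i < n" "j < i" for t i j
  proof -
    have "R i l * pascal_kernel t l j = 0" for l
      using upper[OF that(1), of l] that(2) by (cases "l < i") auto
    then show ?thesis by (simp add: V_def)
  qed
  have V_diag: "V t i i > 0" if "i < n" for t i
  proof -
    have "R i l * pascal_kernel t l i = 0" if "l \<noteq> i" for l
      using upper[OF \<open>i < n\<close>, of l] that by (cases "l < i") auto
    then have "V t i i = (\<Sum>l\<in>{i}. R i l * pascal_kernel t l i)"
      unfolding V_def using that by (intro sum.mono_neutral_right) auto
    then show ?thesis using diag[OF that] by simp
  qed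
  have V_flag: "det_fun k (\<lambda>i j. V t i (\<beta> j)) > 0"
    if t: "t > 0" and \<beta>: "strict_mono_on {..<k} \<beta>" "\<beta> ` {..<k} \<subseteq> {..<n}" for t k \<beta>
    unfolding V_def
  \<comment> \<open>The identity choice yields a strictly positive summand: a leading principal
    minor of \<open>R\<close>, which is a product of diagonal entries, times a flag minor of the
    kernel.\<close>
  proof (rule cauchy_binet_pos[where h = "\<lambda>i. i"])
    show "det_fun k (\<lambda>i j. R i (g j)) * det_fun k (\<lambda>i j. pascal_kernel t (g i) (\<beta> j)) \<ge> 0"
      if "strict_mono_on {..<k} g" "g ` {..<k} \<subseteq> {..<n}" for g
      by (intro mult_nonneg_nonneg flag pascal_kernel_minor_nonneg[of t k g n] t that \<beta>)
    have "k \<le> n" by (rule strict_mono_on_card_le[OF \<beta>])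
    then show "(\<lambda>i. i) ` {..<k} \<subseteq> {..<n}" by auto
    have "det_fun k R = (\<Prod>i<k. R i i)"
      using \<open>k \<le> n\<close> by (intro det_fun_upper_triangular upper) auto
    then have "det_fun k R > 0"
      using diag \<open>k \<le> n\<close> by (auto intro!: prod_pos)
    then show "det_fun k (\<lambda>i j. R i j) * det_fun k (\<lambda>i j. pascal_kernel t i (\<beta> j)) > 0"
      using pascal_kernel_flag_minor_pos[OF t \<beta>(1)] by simp
  qed
  have V_lim: "((\<lambda>t. V t i j) \<longlongrightarrow> R i j) (at_right 0)" if "j < n" for i j
  proof -
    have "((\<lambda>t. V t i j) \<longlongrightarrow> (\<Sum>l<n. R i l * (if l = j then 1 else 0))) (at_right 0)"
      unfolding V_def by (intro tendsto_sum tendsto_mult tendsto_const pascal_kernel_tendsto)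
    also have "(\<Sum>l<n. R i l * (if l = j then 1 else 0)) = R i j"
      using that by (simp add: if_distrib sum.delta cong: if_cong)
    finally show ?thesis .
  qed
  have "((\<lambda>t. det_fun k (\<lambda>i j. V t (\<alpha> i) (\<beta> j))) \<longlongrightarrow> det_fun k (\<lambda>i j. R (\<alpha> i) (\<beta> j))) (at_right 0)"
    using \<beta>(2) by (intro tendsto_det_fun V_lim) auto
  moreover have "\<forall>\<^sub>F t in at_right 0. 0 \<le> det_fun k (\<lambda>i j. V t (\<alpha> i) (\<beta> j))"
    using eventually_at_right_less[of 0]
  proof eventually_elim
    case (elim t)
    show ?case
      by (rule upper_triangular_minor_nonneg[where V = "V t" and n = n,
            OF V_upper V_diag V_flag[OF elim] \<alpha> \<beta>])
  qed
  ultimately show ?thesis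
    by (rule tendsto_lowerbound) simp
qed

section \<open>QR factorisation\<close>

text \<open>The matrix \<open>s\<close> records that the columns of \<open>q\<close> lie in the span of those of \<open>a\<close>,
  which is what keeps the induction in \<open>thin_qr_exists\<close> going.\<close>

definition thin_qr :: "nat \<Rightarrow> nat \<Rightarrow> (nat \<Rightarrow> nat \<Rightarrow> real) \<Rightarrow> (nat \<Rightarrow> nat \<Rightarrow> real)
    \<Rightarrow> (nat \<Rightarrow> nat \<Rightarrow> real) \<Rightarrow> (nat \<Rightarrow> nat \<Rightarrow> real) \<Rightarrow> bool" where
  "thin_qr m n a q r s \<longleftrightarrow>
    (\<forall>l<m. \<forall>j<n. a l j = (\<Sum>i<n. q l i * r i j)) \<and>
    (\<forall>l<m. \<forall>i<n. q l i = (\<Sum>j<n. a l j * s j i)) \<and>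
    (\<forall>i<n. \<forall>j<n. (\<Sum>l<m. q l i * q l j) = (if i = j then 1 else 0)) \<and>
    (\<forall>i<n. \<forall>j<i. r i j = 0) \<and> (\<forall>i<n. r i i > 0)"

text \<open>Gram-Schmidt, one column at a time: subtract from the new column its projection onto the
  earlier \<open>q\<close>-columns and normalise the residual.\<close>

lemma thin_qr_exists:
  fixes a :: "nat \<Rightarrow> nat \<Rightarrow> real"
  assumes "\<And>c. \<forall>l<m. (\<Sum>j<n. c j * a l j) = 0 \<Longrightarrow> \<forall>j<n. c j = 0"
  shows "\<exists>q r s. thin_qr m n a q r s"
  using assms
proof (induction n)
  case 0
  then show ?case by (simp add: thin_qr_def)
next
  case (Suc n)
  have "\<forall>j<n. c j = 0" if "\<forall>l<m. (\<Sum>j<n. c j * a l j) = 0" for c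
  proof (intro allI impI)
    fix j assume "j < n"
    moreover have "\<forall>j<Suc n. (c(n := 0)) j = 0"
      using that by (intro Suc.prems) simp
    ultimately show "c j = 0" by (auto dest: spec[of _ j])
  qed
  then obtain q r s where "thin_qr m n a q r s"
    using Suc.IH by blast
  then have qr: "\<And>l j. l < m \<Longrightarrow> j < n \<Longrightarrow> a l j = (\<Sum>i<n. q l i * r i j)"
    and qs: "\<And>l i. l < m \<Longrightarrow> i < n \<Longrightarrow> q l i = (\<Sum>j<n. a l j * s j i)"
    and orth: "\<And>i j. i < n \<Longrightarrow> j < n \<Longrightarrow> (\<Sum>l<m. q l i * q l j) = (if i = j then 1 else 0)"
    and upper: "\<And>i j. i < n \<Longrightarrow> j < i \<Longrightarrow> r i j = 0" and diag: "\<And>i. i < n \<Longrightarrow> r i i > 0"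
    unfolding thin_qr_def by blast+
  \<comment> \<open>\<open>d\<close> holds the projection coefficients, \<open>u\<close> is the
    residual, and \<open>e\<close> expresses the projection through the columns of
    \<open>a\<close>.\<close>
  define d where "d i = (\<Sum>l<m. q l i * a l n)" for i
  define u where "u l = a l n - (\<Sum>i<n. d i * q l i)" for l
  define e where "e j = (\<Sum>i<n. d i * s j i)" for j
  have u_span: "u l = a l n - (\<Sum>j<n. a l j * e j)" if "l < m" for l
  proof -
    have "(\<Sum>i<n. d i * q l i) = (\<Sum>i<n. \<Sum>j<n. a l j * (d i * s j i))"
      using qs[OF that] by (simp add: sum_distrib_left mult_ac)
    also have "\<dots> = (\<Sum>j<n. a l j * e j)"
      unfolding e_def sum_distrib_left by (rule sum.swap)
    finally show ?thesis by (simp add: u_def)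
  qed
  \<comment> \<open>A vanishing residual would be a dependency between the columns of
    \<open>a\<close> with coefficient 1 at column \<open>n\<close>.\<close>
  have "\<exists>l<m. u l \<noteq> 0"
  proof (rule ccontr)
    assume "\<not> ?thesis"
    then have "\<forall>l<m. (\<Sum>j<Suc n. (if j = n then 1 else - e j) * a l j) = 0"
      using u_span by (simp add: sum_negf mult.commute)
    from Suc.prems[OF this] show False by (metis lessI zero_neq_one)
  qed
  then have norm_pos: "(\<Sum>l<m. (u l)\<^sup>2) > 0"
    by (auto intro!: sum_pos2)
  define \<rho> where "\<rho> = sqrt (\<Sum>l<m. (u l)\<^sup>2)"
  have \<rho>: "\<rho> > 0" "\<rho> * \<rho> = (\<Sum>l<m. (u l)\<^sup>2)"
    using norm_pos by (simp_all add: \<rho>_def)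
  have u_orth: "(\<Sum>l<m. q l i * u l) = 0" if "i < n" for i
  proof -
    have "(\<Sum>l<m. q l i * u l) = d i - (\<Sum>l<m. \<Sum>j<n. d j * (q l i * q l j))"
      by (simp add: u_def d_def right_diff_distrib sum_subtractf sum_distrib_left mult_ac)
    also have "(\<Sum>l<m. \<Sum>j<n. d j * (q l i * q l j)) = (\<Sum>j<n. d j * (\<Sum>l<m. q l i * q l j))"
      unfolding sum_distrib_left by (rule sum.swap)
    also have "\<dots> = d i"
      using that by (simp add: orth if_distrib cong: if_cong)
    finally show ?thesis by simp
  qed
  define q' where "q' l i = (if i = n then u l / \<rho> else q l i)" for l i
  define r' where "r' i j = (if j = n then if i = n then \<rho> else d i else if i = n then 0 else r i j)" for i j
  define s' where "s' j i = (if i = n then (if j = n then 1 else - e j) / \<rho> else if j = n then 0 else s j i)" for j i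
  have "a l j = (\<Sum>i<Suc n. q' l i * r' i j)" if "l < m" "j < Suc n" for l j
    using that qr[of l j] \<rho>(1) by (auto simp: q'_def r'_def u_def mult.commute)
  moreover have "q' l i = (\<Sum>j<Suc n. a l j * s' j i)" if "l < m" "i < Suc n" for l i
    using that qs[of l i] u_span[of l]
    by (auto simp: q'_def s'_def sum_negf diff_divide_distrib sum_divide_distrib)
  moreover have "(\<Sum>l<m. q' l i * q' l j) = (if i = j then 1 else 0)" if ij: "i < Suc n" "j < Suc n" for i j
  proof -
    consider "i = n" "j = n" | "i = n" "j < n" | "i < n" "j = n" | "i < n" "j < n"
      using ij by linarith
    then show ?thesis
    proof cases
      case 1
      then have "(\<Sum>l<m. q' l i * q' l j) = (\<Sum>l<m. (u l)\<^sup>2) / (\<rho> * \<rho>)"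
        by (simp add: q'_def power2_eq_square sum_divide_distrib)
      then show ?thesis using 1 \<rho> by auto
    next
      case 2
      then have "(\<Sum>l<m. q' l i * q' l j) = (\<Sum>l<m. q l j * u l) / \<rho>"
        by (simp add: q'_def sum_divide_distrib mult.commute)
      then show ?thesis using 2 u_orth by simp
    next
      case 3
      then have "(\<Sum>l<m. q' l i * q' l j) = (\<Sum>l<m. q l i * u l) / \<rho>"
        by (simp add: q'_def sum_divide_distrib)
      then show ?thesis using 3 u_orth by simp
    next
      case 4
      then show ?thesis by (simp add: q'_def orth)
    qed
  qed
  moreover have "\<forall>i<Suc n. \<forall>j<i. r' i j = 0" "\<forall>i<Suc n. r' i i > 0"
    using upper diag \<rho>(1) by (auto simp: r'_def less_Suc_eq)
  ultimately have "thin_qr m (Suc n) a q' r' s'"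
    unfolding thin_qr_def by blast
  then show ?case by blast
qed

text \<open>Rank is measured on the set of columns, where repetitions collapse. Full rank therefore
  first forces the columns to be distinct; only then does a kernel vector make this set
  dependent.\<close>

lemma full_rank_columns_independent:
  fixes A :: "real mat"
  assumes A: "A \<in> carrier_mat m n" and rank: "vec_space.rank m A = n"
    and c: "\<forall>l<m. (\<Sum>j<n. c j * A $$ (l, j)) = 0"
  shows "\<forall>j<n. c j = 0"
proof (rule ccontr)
  assume "\<not> ?thesis"
  then obtain j where j: "j < n" "c j \<noteq> 0" by blast
  interpret vec_space "TYPE(real)" m .
  have "finite (set (cols A))" by simp
  moreover have "lin_indpt {}"
    by (metis empty_iff empty_subsetI finite.emptyI finite_lin_indpt2)
  ultimately obtain S where S: "maximal S (\<lambda>T. T \<subseteq> set (cols A) \<and> lin_indpt T)"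
    using maximal_exists_superset[of "set (cols A)" "\<lambda>T. T \<subseteq> set (cols A) \<and> lin_indpt T" "{}"] by auto
  then have "card S \<le> card (set (cols A))"
    by (intro card_mono) (auto simp: maximal_def)
  then have "n \<le> card (set (cols A))"
    using rank rank_card_indpt[OF A S] by simp
  then have dist: "distinct (cols A)"
    using A by (metis card_distinct card_length carrier_matD(2) cols_length le_antisym)
  have "vec n c \<noteq> 0\<^sub>v n"
    using j by (metis index_vec index_zero_vec(1))
  moreover have "A *\<^sub>v vec n c = 0\<^sub>v m"
    using A c by (intro eq_vecI) (auto simp: scalar_prod_def atLeast0LessThan mult.commute)
  ultimately have "lin_dep (set (cols A))"
    by (intro lin_depI[OF A _ _ _ dist]) auto
  then show False
    using full_rank_lin_indpt[OF A rank dist] by simp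
qed

section \<open>Minors of sign regular matrices and of the Gram matrix\<close>

lemma incr_seqs_nth:
  assumes "\<alpha> \<in> incr_seqs k n"
  shows "strict_mono_on {..<k} ((!) \<alpha>)" "(!) \<alpha> ` {..<k} \<subseteq> {..<n}"
proof -
  have \<alpha>: "length \<alpha> = k" "sorted_wrt (<) \<alpha>" "set \<alpha> \<subseteq> {..<n}"
    using assms by (auto simp: incr_seqs_def)
  show "strict_mono_on {..<k} ((!) \<alpha>)"
    using \<alpha> by (intro strict_mono_onI) (simp add: sorted_wrt_nth_less)
  show "(!) \<alpha> ` {..<k} \<subseteq> {..<n}"
    using \<alpha> nth_mem by blast
qed

lemma map_in_incr_seqs:
  assumes "strict_mono_on {..<k} g" "g ` {..<k} \<subseteq> {..<n}"
  shows "map g [0..<k] \<in> incr_seqs k n"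
proof -
  have "sorted_wrt (<) (map g [0..<k])"
    using strict_mono_onD[OF assms(1)] by (simp add: sorted_wrt_iff_nth_less)
  then show ?thesis
    using assms(2) by (auto simp: incr_seqs_def image_subset_iff)
qed

lemma det_minor_mat_eq_det_fun:
  assumes "\<alpha> \<in> incr_seqs k (dim_row A)" "\<beta> \<in> incr_seqs k (dim_col A)"
  shows "det (minor_mat A \<alpha> \<beta>) = det_fun k (\<lambda>i j. A $$ (\<alpha> ! i, \<beta> ! j))"
  unfolding minor_mat_eq[OF assms] det_fun_def ..

text \<open>The sign of a minor depends on its order only, so two minors of equal order never have
  opposite signs. The rows are shared because this product is a Cauchy-Binet summand of a minor of
  the Gram matrix.\<close>

lemma sign_regular_minors_same_sign:
  assumes SR: "sign_regular A \<epsilon>" and A: "A \<in> carrier_mat m n" "n \<le> m"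
    and g: "strict_mono_on {..<k} g" "g ` {..<k} \<subseteq> {..<m}"
    and h: "strict_mono_on {..<k} h" "h ` {..<k} \<subseteq> {..<n}"
    and h': "strict_mono_on {..<k} h'" "h' ` {..<k} \<subseteq> {..<n}"
  shows "det_fun k (\<lambda>i j. A $$ (g i, h j)) * det_fun k (\<lambda>i j. A $$ (g i, h' j)) \<ge> 0"
\<comment> \<open>The signature has no entry for order 0, where both determinants are 1.\<close>
proof (cases "k = 0")
  case False
  have k: "k \<in> {1..n}"
    using strict_mono_on_card_le[OF h] False by simp
  have "dim_vec \<epsilon> = n" "is_signature \<epsilon>"
    using SR A by (auto simp: sign_regular_def Let_def)
  then have sgn: "\<epsilon> $ (k - 1) = 1 \<or> \<epsilon> $ (k - 1) = - 1"
    using k by (auto simp: is_signature_def dest: spec[of _ "k - 1"])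
  have "\<epsilon> $ (k - 1) * det_fun k (\<lambda>i j. A $$ (g i, f j)) \<ge> 0"
    if f: "strict_mono_on {..<k} f" "f ` {..<k} \<subseteq> {..<n}" for f
  proof -
    have "map g [0..<k] \<in> incr_seqs k (dim_row A)" "map f [0..<k] \<in> incr_seqs k (dim_col A)"
      using map_in_incr_seqs[OF g] map_in_incr_seqs[OF f] A by auto
    moreover from this have "\<epsilon> $ (k - 1) * det (minor_mat A (map g [0..<k]) (map f [0..<k])) \<ge> 0"
      using SR A k by (simp add: sign_regular_def Let_def)
    moreover have "det_fun k (\<lambda>i j. A $$ (map g [0..<k] ! i, map f [0..<k] ! j))
        = det_fun k (\<lambda>i j. A $$ (g i, f j))"
      by (rule det_fun_cong) simp
    ultimately show ?thesis by (simp add: det_minor_mat_eq_det_fun)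
  qed
  from this[OF h] this[OF h'] sgn show ?thesis
    by (auto simp: mult_nonpos_nonpos)
qed simp

text \<open>Orthonormality turns the Gram matrix of \<open>a\<close> into that of \<open>r\<close>.
  In its first \<open>k\<close> rows triangularity cuts the inner sum down to \<open>p < k\<close>,
  leaving a product of square matrices.\<close>

lemma gram_flag_minor_factor:
  fixes a q r :: "nat \<Rightarrow> nat \<Rightarrow> real"
  assumes qr: "thin_qr m n a q r s" and k: "k \<le> n" and \<beta>: "\<beta> ` {..<k} \<subseteq> {..<n}"
  shows "det_fun k (\<lambda>i j. \<Sum>l<m. a l i * a l (\<beta> j))
    = (\<Prod>i<k. r i i) * det_fun k (\<lambda>i j. r i (\<beta> j))"
proof -
  have a_eq: "\<And>l j. l < m \<Longrightarrow> j < n \<Longrightarrow> a l j = (\<Sum>i<n. q l i * r i j)"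
    and orth: "\<And>i j. i < n \<Longrightarrow> j < n \<Longrightarrow> (\<Sum>l<m. q l i * q l j) = (if i = j then 1 else 0)"
    and upper: "\<And>i j. i < n \<Longrightarrow> j < i \<Longrightarrow> r i j = 0"
    using qr unfolding thin_qr_def by blast+
  have gram: "(\<Sum>l<m. a l i * a l j) = (\<Sum>p<n. r p i * r p j)" if "i < n" "j < n" for i j
  proof -
    have "(\<Sum>l<m. a l i * a l j) = (\<Sum>l<m. \<Sum>p<n. \<Sum>p'<n. (q l p * r p i) * (q l p' * r p' j))"
      using that by (simp add: a_eq sum_product)
    also have "\<dots> = (\<Sum>p<n. \<Sum>l<m. \<Sum>p'<n. (q l p * r p i) * (q l p' * r p' j))"
      by (rule sum.swap)
    also have "\<dots> = (\<Sum>p<n. \<Sum>p'<n. \<Sum>l<m. (q l p * r p i) * (q l p' * r p' j))"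
      by (intro sum.cong refl sum.swap)
    also have "\<dots> = (\<Sum>p<n. \<Sum>p'<n. r p i * r p' j * (\<Sum>l<m. q l p * q l p'))"
      by (simp add: sum_distrib_left mult_ac)
    also have "\<dots> = (\<Sum>p<n. \<Sum>p'<n. if p = p' then r p i * r p' j else 0)"
      by (intro sum.cong refl) (simp add: orth)
    finally show ?thesis by simp
  qed
  have "det_fun k (\<lambda>i j. \<Sum>l<m. a l i * a l (\<beta> j)) = det_fun k (\<lambda>i j. \<Sum>p<k. r p i * r p (\<beta> j))"
  proof (rule det_fun_cong)
    fix i j assume ij: "i < k" "j < k"
    then have "i < n" "\<beta> j < n" using k \<beta> by auto
    then show "(\<Sum>l<m. a l i * a l (\<beta> j)) = (\<Sum>p<k. r p i * r p (\<beta> j))"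
      unfolding gram[OF \<open>i < n\<close> \<open>\<beta> j < n\<close>] using k ij upper
      by (intro sum.mono_neutral_right) auto
  qed
  also have "\<dots> = det_fun k (\<lambda>i j. r j i) * det_fun k (\<lambda>i j. r i (\<beta> j))"
    by (rule det_fun_mult)
  also have "det_fun k (\<lambda>i j. r j i) = det_fun k r"
    by (rule det_fun_transpose)
  also have "\<dots> = (\<Prod>i<k. r i i)"
    using k upper by (intro det_fun_upper_triangular) auto
  finally show ?thesis .
qed

section \<open>The staircase pattern from minors of order one and two\<close>

lemma det_fun_1: "det_fun (Suc 0) M = M 0 0"
  by (simp add: det_fun_expand_first_column)

lemma det_fun_2: "det_fun (Suc (Suc 0)) M = M 0 0 * M 1 1 - M 0 1 * M 1 0"
  by (simp add: det_fun_expand_first_column insert_index_def)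

text \<open>A zero moves up by the minor with rows \<open>k, i\<close> and columns
  \<open>i, j\<close>, then right by the one with rows \<open>k, j\<close> and columns
  \<open>j, l\<close>. In each, the product of the next entry with a positive diagonal entry is
  bounded above by 0.\<close>

lemma upper_triangular_zero_propagates:
  fixes r :: "nat \<Rightarrow> nat \<Rightarrow> real"
  assumes minors: "\<And>k \<alpha> \<beta>. strict_mono_on {..<k} \<alpha> \<Longrightarrow> \<alpha> ` {..<k} \<subseteq> {..<n} \<Longrightarrow>
      strict_mono_on {..<k} \<beta> \<Longrightarrow> \<beta> ` {..<k} \<subseteq> {..<n} \<Longrightarrow> det_fun k (\<lambda>i j. r (\<alpha> i) (\<beta> j)) \<ge> 0"
    and diag: "\<And>i. i < n \<Longrightarrow> r i i > 0"
    and ij: "i < j" "j < n" "r i j = 0" and kl: "k \<le> i" "j \<le> l" "l < n"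
  shows "r k l = 0"
proof -
  have entry: "r x y \<ge> 0" if "x < n" "y < n" for x y
  proof -
    have "det_fun (Suc 0) (\<lambda>i j. r ((\<lambda>_. x) i) ((\<lambda>_. y) j)) \<ge> 0"
      using that by (intro minors strict_mono_onI) auto
    then show ?thesis by (simp add: det_fun_1)
  qed
  have minor2: "r x y * r x' y' \<ge> r x y' * r x' y" if "x < x'" "x' < n" "y < y'" "y' < n" for x x' y y'
  proof -
    have "det_fun (Suc (Suc 0)) (\<lambda>i j. r (case_nat x (\<lambda>_. x') i) (case_nat y (\<lambda>_. y') j)) \<ge> 0"
      using that by (intro minors strict_mono_onI) (auto simp: less_Suc_eq)
    then show ?thesis by (simp add: det_fun_2)
  qed
  have right: "r x l = 0" if "x < j" "r x j = 0" for x
  proof (cases "l = j")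
    case False
    then have "r x j * r j l \<ge> r x l * r j j"
      using minor2[of x j j l] that ij kl by simp
    then show ?thesis
      using that diag[of j] entry[of x l] ij kl by (simp add: mult_le_0_iff)
  qed (use that in simp)
  have "r k j = 0"
  proof (cases "k = i")
    case False
    then have "r k i * r i j \<ge> r k j * r i i"
      using minor2[of k i i j] ij kl by simp
    then show ?thesis
      using diag[of i] entry[of k j] ij kl by (simp add: mult_le_0_iff)
  qed (use ij in simp)
  then show ?thesis using right[of k] ij kl by simp
qed

theorem theorem4p3:
  fixes A :: "real mat" and \<epsilon> :: "real vec" and m n :: nat
  assumes "A \<in> carrier_mat m n"
    and "m \<ge> n"
    and "vec_space.rank m A = n"
    and "sign_regular A \<epsilon>"
  shows "\<exists>Q R :: real mat.
    Q \<in> carrier_mat m n \<and> R \<in> carrier_mat n n \<and>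
    A = Q * R \<and>
    transpose_mat Q * Q = 1\<^sub>m n \<and>
    invertible_mat R \<and> upper_triangular R \<and> totally_positive R"
proof -
  note A = assms(1) and SR = assms(4)
  define a where "a l j = A $$ (l, j)" for l j
  have "\<forall>j<n. c j = 0" if "\<forall>l<m. (\<Sum>j<n. c j * a l j) = 0" for c
    using full_rank_columns_independent[OF A assms(3)] that unfolding a_def by blast
  then obtain q r s where qr: "thin_qr m n a q r s"
    using thin_qr_exists by blast
  have a_eq: "\<And>l j. l < m \<Longrightarrow> j < n \<Longrightarrow> a l j = (\<Sum>i<n. q l i * r i j)"
    and orth: "\<And>i j. i < n \<Longrightarrow> j < n \<Longrightarrow> (\<Sum>l<m. q l i * q l j) = (if i = j then 1 else 0)"
    and upper: "\<And>i j. i < n \<Longrightarrow> j < i \<Longrightarrow> r i j = 0" and diag: "\<And>i. i < n \<Longrightarrow> r i i > 0"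
    using qr unfolding thin_qr_def by blast+
  \<comment> \<open>The Gram minor on initial rows is nonnegative by Cauchy-Binet and equals the
    flag minor of \<open>r\<close> times a positive product of diagonal entries.\<close>
  have flag: "det_fun k (\<lambda>i j. r i (\<beta> j)) \<ge> 0"
    if \<beta>: "strict_mono_on {..<k} \<beta>" "\<beta> ` {..<k} \<subseteq> {..<n}" for k \<beta>
  proof -
    have k: "k \<le> n" by (rule strict_mono_on_card_le[OF \<beta>])
    have "det_fun k (\<lambda>i j. \<Sum>l<m. a l i * a l (\<beta> j)) \<ge> 0"
    proof (rule cauchy_binet_nonneg)
      fix g assume g: "strict_mono_on {..<k} g" "g ` {..<k} \<subseteq> {..<m}"
      have "det_fun k (\<lambda>i j. a (g i) j) * det_fun k (\<lambda>i j. a (g i) (\<beta> j)) \<ge> 0"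
        unfolding a_def using k
        by (intro sign_regular_minors_same_sign[OF SR A assms(2) g _ _ \<beta>]) (auto intro: strict_mono_onI)
      then show "det_fun k (\<lambda>i j. a (g j) i) * det_fun k (\<lambda>i j. a (g i) (\<beta> j)) \<ge> 0"
        by (simp add: det_fun_transpose[of k "\<lambda>i j. a (g i) j"])
    qed
    moreover have "(\<Prod>i<k. r i i) > 0"
      using diag k by (intro prod_pos) simp
    ultimately show ?thesis
      unfolding gram_flag_minor_factor[OF qr k \<beta>(2)] by (simp add: zero_le_mult_iff)
  qed
  have minors: "det_fun k (\<lambda>i j. r (\<alpha> i) (\<beta> j)) \<ge> 0"
    if "strict_mono_on {..<k} \<alpha>" "\<alpha> ` {..<k} \<subseteq> {..<n}" "strict_mono_on {..<k} \<beta>" "\<beta> ` {..<k} \<subseteq> {..<n}"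
    for k \<alpha> \<beta>
    by (rule upper_triangular_flag_nonneg_imp_minor_nonneg[where R = r and n = n, OF upper diag flag that])
  define Q where "Q = mat m n (\<lambda>(l, i). q l i)"
  define R where "R = mat n n (\<lambda>(i, j). r i j)"
  have carrier: "Q \<in> carrier_mat m n" "R \<in> carrier_mat n n"
    by (simp_all add: Q_def R_def)
  have R_nth [simp]: "R $$ (i, j) = r i j" if "i < n" "j < n" for i j
    using that by (simp add: R_def)
  have "A = Q * R"
    using A a_eq by (intro eq_matI) (auto simp: Q_def R_def a_def scalar_prod_def atLeast0LessThan)
  have "transpose_mat Q * Q = 1\<^sub>m n"
    using orth by (intro eq_matI) (auto simp: Q_def scalar_prod_def atLeast0LessThan)
  have "upper_triangular R"
    using upper carrier(2) by auto
  have det_R: "det R \<noteq> 0"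
  proof -
    have "det R = (\<Prod>i<n. r i i)"
      unfolding R_def det_fun_def[symmetric] by (rule det_fun_upper_triangular) (rule upper)
    also have "\<dots> > 0" using diag by (intro prod_pos) simp
    finally show ?thesis by simp
  qed
  from this have "invertible_mat R"
    using det_non_zero_imp_unit[OF carrier(2), of undefined] carrier(2)
    by (auto simp: invertible_mat_def inverts_mat_def Units_def ring_mat_def)
  have "type1_staircase R"
    unfolding type1_staircase_def
  proof (intro conjI allI impI)
    show "R $$ (i, i) \<noteq> 0" if "i < min (dim_row R) (dim_col R)" for i
      using that carrier(2) diag[of i] by simp
    fix i j k l
    assume i: "i < dim_row R" and j: "j < dim_col R" and k: "k < dim_row R" and l: "l < dim_col R"
    \<comment> \<open>Going down and to the left from a place below the diagonal stays below it,
      where all entries vanish.\<close>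
    show "R $$ (k, l) = 0" if "j < i \<and> R $$ (i, j) = 0" "i \<le> k \<and> l \<le> j"
      using that k l carrier(2) upper[of k l] by simp
    show "R $$ (k, l) = 0" if "i < j \<and> R $$ (i, j) = 0" "k \<le> i \<and> j \<le> l"
    proof -
      have "r k l = 0"
        by (rule upper_triangular_zero_propagates[where r = r and n = n and i = i and j = j, OF minors diag])
          (use that i j k l carrier(2) in simp_all)
      then show ?thesis using k l carrier(2) by simp
    qed
  qed
  have minor_R: "det (minor_mat R \<alpha> \<beta>) \<ge> 0"
    if "\<alpha> \<in> incr_seqs k n" "\<beta> \<in> incr_seqs k n" for k \<alpha> \<beta>
  proof -
    note \<alpha> = incr_seqs_nth[OF that(1)] and \<beta> = incr_seqs_nth[OF that(2)]
    have "det (minor_mat R \<alpha> \<beta>) = det_fun k (\<lambda>i j. R $$ (\<alpha> ! i, \<beta> ! j))"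
      using that carrier(2) by (intro det_minor_mat_eq_det_fun) simp_all
    also have "\<dots> = det_fun k (\<lambda>i j. r (\<alpha> ! i) (\<beta> ! j))"
      using \<alpha>(2) \<beta>(2) by (intro det_fun_cong R_nth) auto
    finally show ?thesis using minors[OF \<alpha> \<beta>] by simp
  qed
  have "vec_space.rank n R = n"
    by (rule vec_space.low_rank_det_zero[OF carrier(2) det_R])
  then have "totally_positive R"
    unfolding totally_positive_def sign_regular_def Let_def
      carrier_matD[OF carrier(2)] min.idem
    using \<open>type1_staircase R\<close> minor_R by (auto simp: is_signature_def)
  show ?thesis
    by (intro exI[of _ Q] exI[of _ R] conjI) fact+
qed

end
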